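(* Let $\hat a_x,\hat a_z\in\mathcal{F}$ be such that the length of $x$ is (strictly) larger than the length of $z$. Then $$\sum_{y}\Big(\int\hat a_x\hat a_z\hat a_y\,d\mu\Big)^2=\Big(\int\hat a_x^2\hat a_z\,d\mu\Big)^2+\Big(\int\hat a_z^2\hat a_x\,d\mu\Big)^2=\Big(\int\hat a_x^2\hat a_z\,d\mu\Big)^2,$$ where $y$ ranges over all words indexing $\mathcal{F}$.
   Context: Let $r,s\in(0,1)$, $P=\begin{pmatrix}P_{0,0}&P_{0,1}\\P_{1,0}&P_{1,1}\end{pmatrix}=\begin{pmatrix}r&1-r\\1-s&s\end{pmatrix}$, and let $\pi=(\pi_0,\pi_1)$ be the probability vector with $\pi P=\pi$. On $\{0,1\}^{\mathbb N}$ let $\mu$ be the Markov probability $\mu[x_1,\dots,x_n]=\pi_{x_1}P_{x_1,x_2}\cdots P_{x_{n-1},x_n}$. For a finite word $x=(x_1,\dots,x_n)$, $n\ge1$, $[x]$ is its cylinder and $$e_{[x]}=\tfrac{1}{\sqrt{\mu([x])}}\Big(\sqrt{\tfrac{P_{x_n,1}}{P_{x_n,0}}}\,1_{[x0]}-\sqrt{\tfrac{P_{x_n,0}}{P_{x_n,1}}}\,1_{[x1]}\Big),\quad a_x=\sqrt{\tfrac{\pi_{x_1}}{\pi_0P_{0,x_1}}}\,e_{[0x]}-\sqrt{\tfrac{\pi_{x_1}}{\pi_1P_{1,x_1}}}\,e_{[1x]},\quad \hat a_x=\frac{a_x}{|a_x|},$$ with $|\cdot|$ the $L^2(\mu)$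 norm. Also $V_1=\pi_1P_{1,0}1_{[00]}-\pi_0P_{0,0}1_{[10]}$, $V_2=\pi_0P_{0,1}1_{[11]}-\pi_1P_{1,1}1_{[01]}$, $\hat a_\emptyset^0=V_1/|V_1|$, $\hat a_\emptyset^1=V_2/|V_2|$. $\mathcal{F}$ is the family of all $\hat a_x$ ($x$ a finite word of length $\ge1$) together with $\hat a_\emptyset^0,\hat a_\emptyset^1$ (attached to two versions $\emptyset^0,\emptyset^1$ of the empty word, of length $0$); a generic element of $\mathcal{F}$ is written $\hat a_x$. *)

theory Defs
  imports "HOL-Probability.Probability"
begin

text \<open>
  The alphabet \<open>{0,1}\<close> is \<^typ>\<open>bool\<close>, with \<open>0 = False\<close> and \<open>1 = True\<close>.  Points of
  \<open>{0,1}\<^sup>\<nat>\<close> are functions \<^typ>\<open>nat \<Rightarrow> bool\<close> and finite words are lists; both are indexed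
  from \<open>0\<close>, so the letter \<open>x\<^sub>1\<close> of a word is its head.
\<close>

type_synonym seq = "nat \<Rightarrow> bool"
type_synonym word = "bool list"

definition transition :: "real \<Rightarrow> real \<Rightarrow> bool \<Rightarrow> bool \<Rightarrow> real" where
  "transition r s i j =
     (case (i, j) of
        (False, False) \<Rightarrow> r
      | (False, True) \<Rightarrow> 1 - r
      | (True, False) \<Rightarrow> 1 - s
      | (True, True) \<Rightarrow> s)"

definition stationary :: "(bool \<Rightarrow> bool \<Rightarrow> real) \<Rightarrow> (bool \<Rightarrow> real) \<Rightarrow> bool" where
  "stationary P \<pi> \<longleftrightarrow>
     (\<forall>i. 0 \<le> \<pi> i) \<and> (\<Sum>i\<in>UNIV. \<pi> i) = 1 \<and> (\<forall>j. (\<Sum>i\<in>UNIV. \<pi> i * P i j) = \<pi> j)"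

definition cylinder :: "word \<Rightarrow> seq set" where
  "cylinder x = {\<omega>. \<forall>i<length x. \<omega> i = x ! i}"

text \<open>
  The Markov probability is characterised by its values on cylinders, which form (together with
  the empty set) an intersection-stable generator of the product sigma-algebra.  Its existence
  is \<open>markov_measure_exists\<close> below.
\<close>

definition markov_measure ::
    "(bool \<Rightarrow> bool \<Rightarrow> real) \<Rightarrow> (bool \<Rightarrow> real) \<Rightarrow> seq measure \<Rightarrow> bool" where
  "markov_measure P \<pi> \<mu> \<longleftrightarrow>
     prob_space \<mu> \<and>
     sets \<mu> = sets (\<Pi>\<^sub>M i\<in>UNIV. count_space UNIV) \<and>
     (\<forall>x. x \<noteq> [] \<longrightarrow>
        measure \<mu> (cylinder x) = \<pi> (hd x) * (\<Prod>i<length x - 1. P (x ! i) (x ! Suc i)))"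

definition e_cyl :: "(bool \<Rightarrow> bool \<Rightarrow> real) \<Rightarrow> seq measure \<Rightarrow> word \<Rightarrow> seq \<Rightarrow> real" where
  "e_cyl P \<mu> x \<omega> =
     1 / sqrt (measure \<mu> (cylinder x)) *
     (sqrt (P (last x) True / P (last x) False) * indicator (cylinder (x @ [False])) \<omega> -
      sqrt (P (last x) False / P (last x) True) * indicator (cylinder (x @ [True])) \<omega>)"

definition a_word :: "(bool \<Rightarrow> bool \<Rightarrow> real) \<Rightarrow> (bool \<Rightarrow> real) \<Rightarrow> seq measure \<Rightarrow> word \<Rightarrow> seq \<Rightarrow> real" where
  "a_word P \<pi> \<mu> x \<omega> =
     sqrt (\<pi> (hd x) / (\<pi> False * P False (hd x))) * e_cyl P \<mu> (False # x) \<omega> -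
     sqrt (\<pi> (hd x) / (\<pi> True * P True (hd x))) * e_cyl P \<mu> (True # x) \<omega>"

definition V1 :: "(bool \<Rightarrow> bool \<Rightarrow> real) \<Rightarrow> (bool \<Rightarrow> real) \<Rightarrow> seq \<Rightarrow> real" where
  "V1 P \<pi> \<omega> =
     \<pi> True * P True False * indicator (cylinder [False, False]) \<omega> -
     \<pi> False * P False False * indicator (cylinder [True, False]) \<omega>"

definition V2 :: "(bool \<Rightarrow> bool \<Rightarrow> real) \<Rightarrow> (bool \<Rightarrow> real) \<Rightarrow> seq \<Rightarrow> real" where
  "V2 P \<pi> \<omega> =
     \<pi> False * P False True * indicator (cylinder [True, True]) \<omega> -
     \<pi> True * P True True * indicator (cylinder [False, True]) \<omega>"

definition L2norm :: "seq measure \<Rightarrow> (seq \<Rightarrow> real) \<Rightarrow> real" where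
  "L2norm \<mu> f = sqrt (\<integral>\<omega>. (f \<omega>)\<^sup>2 \<partial>\<mu>)"

text \<open>
  \<open>Empty0\<close> and \<open>Empty1\<close> are the two versions of the empty word; \<open>Word []\<close> is a junk value, which
  is not in \<open>indices\<close>.
\<close>

datatype index = Empty0 | Empty1 | Word word

definition indices :: "index set" where
  "indices = {Empty0, Empty1} \<union> {Word x | x. x \<noteq> []}"

fun len :: "index \<Rightarrow> nat" where
  "len Empty0 = 0"
| "len Empty1 = 0"
| "len (Word x) = length x"

fun unnormalized ::
    "(bool \<Rightarrow> bool \<Rightarrow> real) \<Rightarrow> (bool \<Rightarrow> real) \<Rightarrow> seq measure \<Rightarrow> index \<Rightarrow> seq \<Rightarrow> real" where
  "unnormalized P \<pi> \<mu> Empty0 = V1 P \<pi>"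
| "unnormalized P \<pi> \<mu> Empty1 = V2 P \<pi>"
| "unnormalized P \<pi> \<mu> (Word x) = a_word P \<pi> \<mu> x"

definition hat_a ::
    "(bool \<Rightarrow> bool \<Rightarrow> real) \<Rightarrow> (bool \<Rightarrow> real) \<Rightarrow> seq measure \<Rightarrow> index \<Rightarrow> seq \<Rightarrow> real" where
  "hat_a P \<pi> \<mu> x \<omega> = unnormalized P \<pi> \<mu> x \<omega> / L2norm \<mu> (unnormalized P \<pi> \<mu> x)"

lemma stationary_transition_iff:
  assumes "0 < r" "r < 1" "0 < s" "s < 1"
  shows "stationary (transition r s) \<pi> \<longleftrightarrow>
    \<pi> False = (1 - s) / (2 - r - s) \<and> \<pi> True = (1 - r) / (2 - r - s)"
proof -
  have p: "2 - r - s > 0" using assms by simp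
  have *: "stationary (transition r s) \<pi> \<longleftrightarrow>
      0 \<le> \<pi> False \<and> 0 \<le> \<pi> True \<and> \<pi> False + \<pi> True = 1 \<and>
      \<pi> False * r + \<pi> True * (1 - s) = \<pi> False \<and> \<pi> False * (1 - r) + \<pi> True * s = \<pi> True"
    by (auto simp: stationary_def transition_def UNIV_bool all_bool_eq add.commute)
  show ?thesis
  proof
    assume "stationary (transition r s) \<pi>"
    then have sum: "\<pi> True = 1 - \<pi> False" and "\<pi> False * r + \<pi> True * (1 - s) = \<pi> False"
      using * by auto
    then have "\<pi> False * r + (1 - \<pi> False) * (1 - s) = \<pi> False" by simp
    then have "\<pi> False * (2 - r - s) = 1 - s" by (simp only: algebra_simps)
    then have F: "\<pi> False = (1 - s) / (2 - r - s)" using p by (simp add: eq_divide_eq)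
    have "\<pi> True = (1 - r) / (2 - r - s)"
      unfolding sum F using p by (simp add: diff_divide_eq_iff)
    with F show "\<pi> False = (1 - s) / (2 - r - s) \<and> \<pi> True = (1 - r) / (2 - r - s)" ..
  next
    assume h: "\<pi> False = (1 - s) / (2 - r - s) \<and> \<pi> True = (1 - r) / (2 - r - s)"
    have "(1 - s) / d + (1 - r) / d = 1" "(1 - s) / d * r + (1 - r) / d * (1 - s) = (1 - s) / d"
      "(1 - s) / d * (1 - r) + (1 - r) / d * s = (1 - r) / d"
      if d: "d = 2 - r - s" for d
    proof -
      have "d \<noteq> 0" using d p by simp
      then show "(1 - s) / d + (1 - r) / d = 1"
        by (simp add: d add_divide_distrib[symmetric])
      show "(1 - s) / d * r + (1 - r) / d * (1 - s) = (1 - s) / d"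
        by (simp add: add_divide_distrib[symmetric]) (simp add: algebra_simps)
      show "(1 - s) / d * (1 - r) + (1 - r) / d * s = (1 - r) / d"
        by (simp add: add_divide_distrib[symmetric]) (simp add: algebra_simps)
    qed
    then show "stationary (transition r s) \<pi>"
      unfolding * using p assms h by simp
  qed
qed

text \<open>
  Existence of the Markov probability: drive the chain by independent random maps
  \<open>g\<^sub>k : {0,1} \<rightarrow> {0,1}\<close>, encoded as pairs \<open>(g\<^sub>k 0, g\<^sub>k 1)\<close>.
\<close>

lemma markov_measure_exists:
  assumes P0: "\<And>i j. 0 \<le> P i j" and P1: "\<And>i. P i False + P i True = 1"
    and \<pi>0: "\<And>i. 0 \<le> \<pi> i" and \<pi>1: "\<pi> False + \<pi> True = 1"
  shows "\<exists>\<mu>. markov_measure P \<pi> \<mu>"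
proof -
  define B where "B p = bernoulli_pmf p" for p :: real
  define K :: "nat \<Rightarrow> (bool \<times> bool) pmf" where
    "K = (\<lambda>k. case k of 0 \<Rightarrow> pair_pmf (B (\<pi> True)) (B (\<pi> True))
                | Suc _ \<Rightarrow> pair_pmf (B (P False True)) (B (P True True)))"
  define ap :: "bool \<times> bool \<Rightarrow> bool \<Rightarrow> bool" where "ap = (\<lambda>g b. if b then snd g else fst g)"
  define X :: "(nat \<Rightarrow> bool \<times> bool) \<Rightarrow> nat \<Rightarrow> bool" where
    "X = (\<lambda>g n. rec_nat (ap (g 0) False) (\<lambda>k b. ap (g (Suc k)) b) n)"
  have X0: "X g 0 = ap (g 0) False" and XS: "X g (Suc n) = ap (g (Suc n)) (X g n)" for g n
    by (simp_all add: X_def)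
  interpret product_prob_space "\<lambda>k. measure_pmf (K k)" UNIV
    by unfold_locales
  let ?N = "\<Pi>\<^sub>M k\<in>UNIV. measure_pmf (K k)"
  let ?S = "\<Pi>\<^sub>M i\<in>(UNIV::nat set). count_space (UNIV::bool set)"
  have comp: "(\<lambda>g. g n) \<in> ?N \<rightarrow>\<^sub>M count_space UNIV" for n
    using measurable_component_singleton[of n UNIV "\<lambda>k. measure_pmf (K k)"] by simp
  have Xn: "(\<lambda>g. X g n) \<in> ?N \<rightarrow>\<^sub>M count_space UNIV" for n
  proof (induction n)
    case 0
    show ?case unfolding X0
      using measurable_compose[OF comp[of 0], of "\<lambda>p. ap p False" "count_space UNIV"] by simp
  next
    case (Suc n)
    have "(\<lambda>g. (\<lambda>b g. ap (g (Suc n)) b) (X g n) g) \<in> ?N \<rightarrow>\<^sub>M count_space UNIV"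
    proof (rule measurable_compose_countable[OF _ Suc])
      fix b
      show "(\<lambda>g. ap (g (Suc n)) b) \<in> ?N \<rightarrow>\<^sub>M count_space UNIV"
        using measurable_compose[OF comp[of "Suc n"], of "\<lambda>p. ap p b" "count_space UNIV"] by simp
    qed
    then show ?case unfolding XS by simp
  qed
  have XM: "X \<in> ?N \<rightarrow>\<^sub>M ?S"
    by (rule measurable_PiM_single') (use Xn in \<open>auto simp: space_PiM\<close>)
  have marg: "measure (measure_pmf (pair_pmf (B p) (B q))) {g. ap g b = c} =
      (if c then (if b then q else p) else 1 - (if b then q else p))"
    if "0 \<le> p" "p \<le> 1" "0 \<le> q" "q \<le> 1" for p q b c
  proof -
    have "measure (measure_pmf (pair_pmf (B p) (B q))) {g. ap g b = c} =
        measure (measure_pmf (map_pmf (\<lambda>g. ap g b) (pair_pmf (B p) (B q)))) {c}"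
      by (simp add: vimage_def)
    also have "map_pmf (\<lambda>g. ap g b) (pair_pmf (B p) (B q)) = B (if b then q else p)"
      by (cases b) (simp_all add: ap_def map_fst_pair_pmf map_snd_pair_pmf)
    finally show ?thesis
      using that by (cases c) (auto simp: measure_pmf_single B_def)
  qed
  have le: "P i True \<le> 1" "\<pi> True \<le> 1" for i
    using P0[of i False] P1[of i] \<pi>0[of False] \<pi>1 by auto
  have m0: "measure (measure_pmf (K 0)) {g. ap g b = c} = \<pi> c" for b c
    using \<pi>1 marg[OF \<pi>0 le(2) \<pi>0 le(2), of b c] by (cases c) (simp_all add: K_def)
  have mS: "measure (measure_pmf (K (Suc k))) {g. ap g b = c} = P b c" for k b c
  proof -
    have "measure (measure_pmf (K (Suc k))) {g. ap g b = c} =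
        (if c then (if b then P True True else P False True)
         else 1 - (if b then P True True else P False True))"
      unfolding K_def nat.case by (rule marg) (rule P0 le(1))+
    then show ?thesis
      using P1[of True] P1[of False] by (cases b; cases c) auto
  qed
  have cyl_sets: "cylinder x \<in> sets ?S" for x
  proof -
    have "{\<omega> \<in> space ?S. \<forall>i\<in>{..<length x}. \<omega> i = x ! i} \<in> sets ?S"
      by measurable
    moreover have "{\<omega> \<in> space ?S. \<forall>i\<in>{..<length x}. \<omega> i = x ! i} = cylinder x"
      by (auto simp: cylinder_def space_PiM)
    ultimately show ?thesis by metis
  qed
  have "measure (distr ?N ?S X) (cylinder x) =
      \<pi> (hd x) * (\<Prod>i<length x - 1. P (x ! i) (x ! Suc i))" if "x \<noteq> []" for x
  proof -
    define A where "A = (\<lambda>k. {g. ap g (case k of 0 \<Rightarrow> False | Suc j \<Rightarrow> x ! j) = x ! k})"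
    have "X g \<in> cylinder x \<longleftrightarrow> (\<forall>k<length x. g k \<in> A k)" for g
    proof -
      have "(\<forall>k<n. X g k = x ! k) \<longleftrightarrow> (\<forall>k<n. g k \<in> A k)" for n
      proof (induction n)
        case (Suc n)
        show ?case
        proof (cases n)
          case 0
          then show ?thesis by (simp add: X0 A_def)
        next
          case (Suc m)
          have "(\<forall>k<Suc n. X g k = x ! k) \<longleftrightarrow> (\<forall>k<n. X g k = x ! k) \<and> X g n = x ! n"
            by (auto simp: less_Suc_eq)
          also have "\<dots> \<longleftrightarrow> (\<forall>k<n. X g k = x ! k) \<and> g n \<in> A n"
            using Suc by (auto simp: XS A_def)
          also have "\<dots> \<longleftrightarrow> (\<forall>k<n. g k \<in> A k) \<and> g n \<in> A n"
            using Suc.IH by simp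
          also have "\<dots> \<longleftrightarrow> (\<forall>k<Suc n. g k \<in> A k)"
            by (auto simp: less_Suc_eq)
          finally show ?thesis .
        qed
      qed simp
      then show ?thesis by (simp add: cylinder_def)
    qed
    then have "X -` cylinder x \<inter> space ?N =
        prod_emb UNIV (\<lambda>k. measure_pmf (K k)) {..<length x} (Pi\<^sub>E {..<length x} A)"
      by (simp add: set_eq_iff prod_emb_iff restrict_PiE_iff space_PiM Ball_def Pi_iff)
    then have "measure (distr ?N ?S X) (cylinder x) = (\<Prod>k<length x. measure (measure_pmf (K k)) (A k))"
      by (subst measure_distr[OF XM cyl_sets]) (simp add: measure_PiM_emb)
    also have "\<dots> = (\<Prod>k<Suc (length x - 1). measure (measure_pmf (K k)) (A k))"
      using that by simp
    also have "\<dots> = \<pi> (hd x) * (\<Prod>i<length x - 1. P (x ! i) (x ! Suc i))"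
      using that by (subst prod.lessThan_Suc_shift) (simp add: A_def m0 mS hd_conv_nth)
    finally show ?thesis .
  qed
  then have "markov_measure P \<pi> (distr ?N ?S X)"
    unfolding markov_measure_def using prob_space_distr[OF XM] by simp
  then show ?thesis ..
qed

end

theory Submission
  imports Defs
begin

text \<open>
  The function \<open>a\<^sub>x\<close> depends only on the first \<open>|x| + 2\<close> coordinates and integrates to \<open>0\<close> over the
  last of these when the others are fixed, so it is orthogonal to every function of the first
  \<open>|x| + 1\<close> coordinates.  Hence an integral of a triple product in which one index is strictly
  longer than the two others vanishes.  As \<open>|z| < |x|\<close>, only the indices \<open>y\<close> with \<open>|y| = |x|\<close>
  can contribute, and among these \<open>a\<^sub>x\<close> and \<open>a\<^sub>y\<close> have disjoint supports unless \<open>y = x\<close>.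
\<close>

text \<open>Stands in for measurability with respect to the first \<open>n\<close> coordinates. In
  this pointwise form, \<open>f\<close> is constant on every cylinder of length \<open>n\<close> and
  can be pulled out of an integral over it.\<close>

definition depends_on_prefix :: "nat \<Rightarrow> (seq \<Rightarrow> real) \<Rightarrow> bool" where
  "depends_on_prefix n f \<longleftrightarrow> (\<forall>\<omega> \<omega>'. (\<forall>i<n. \<omega> i = \<omega>' i) \<longrightarrow> f \<omega> = f \<omega>')"

lemma depends_on_prefixD:
  assumes "depends_on_prefix n f" "\<And>i. i < n \<Longrightarrow> \<omega> i = \<omega>' i"
  shows "f \<omega> = f \<omega>'"
  using assms(1)[unfolded depends_on_prefix_def, THEN spec[of _ \<omega>], THEN spec[of _ \<omega>']] assms(2)
  by simp

lemma depends_on_prefix_mono: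
  assumes "depends_on_prefix m f" "m \<le> n"
  shows "depends_on_prefix n f"
  unfolding depends_on_prefix_def
  by (intro allI impI depends_on_prefixD[OF assms(1)]) (use assms(2) in simp)

lemma depends_on_prefix_mult:
  assumes "depends_on_prefix n f" "depends_on_prefix n g"
  shows "depends_on_prefix n (\<lambda>\<omega>. f \<omega> * g \<omega>)"
  unfolding depends_on_prefix_def
proof (intro allI impI)
  fix \<omega> \<omega>' :: seq
  assume eq: "\<forall>i<n. \<omega> i = \<omega>' i"
  show "f \<omega> * g \<omega> = f \<omega>' * g \<omega>'"
    using eq by (intro arg_cong2[of _ _ _ _ "(*)"] depends_on_prefixD[OF assms(1)]
        depends_on_prefixD[OF assms(2)]) auto
qed

lemma indicator_cylinder_cong:
  assumes "length w \<le> n" "\<forall>i<n. \<omega> i = \<omega>' i"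
  shows "(indicator (cylinder w) \<omega> :: real) = indicator (cylinder w) \<omega>'"
  using assms by (auto simp: indicator_def cylinder_def)

lemma cylinder_append_subset: "cylinder (w @ v) \<subseteq> cylinder w"
  by (auto simp: cylinder_def nth_append)

lemma cylinder_disjoint:
  assumes "length v = length w" "v \<noteq> w"
  shows "cylinder v \<inter> cylinder w = {}"
  using assms by (auto simp: cylinder_def list_eq_iff_nth_eq)

text \<open>The two extra coordinates are the letter prepended in \<open>a_word\<close> and the one
  appended in \<open>e_cyl\<close>. The bound also fits the empty words, since \<open>V1\<close> and
  \<open>V2\<close> use cylinders of length 2.\<close>

lemma depends_on_prefix_hat_a: "depends_on_prefix (len x + 2) (hat_a P \<pi> \<mu> x)"
proof -
  have "unnormalized P \<pi> \<mu> x \<omega> = unnormalized P \<pi> \<mu> x \<omega>'"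
    if eq: "\<forall>i<len x + 2. \<omega> i = \<omega>' i" for \<omega> \<omega>'
  proof -
    have "(indicator (cylinder w) \<omega> :: real) = indicator (cylinder w) \<omega>'"
      if "length w \<le> len x + 2" for w
      using indicator_cylinder_cong[OF that eq] .
    then show ?thesis
      by (cases x) (simp_all add: V1_def V2_def a_word_def e_cyl_def)
  qed
  then show ?thesis
    by (simp add: depends_on_prefix_def hat_a_def)
qed

lemma e_cyl_eq_0: "\<omega> \<notin> cylinder w \<Longrightarrow> e_cyl P \<mu> w \<omega> = 0"
  using cylinder_append_subset[of w] by (auto simp: e_cyl_def indicator_def)

text \<open>\<open>a_word\<close> of \<open>w\<close> lives on the sequences that spell
  \<open>w\<close> from their second letter on, whatever the first letter is.\<close>

lemma a_word_mult_eq_0: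
  assumes "length v = length w" "v \<noteq> w"
  shows "a_word P \<pi> \<mu> v \<omega> * a_word P \<pi> \<mu> w \<omega> = 0"
proof -
  have "\<omega> \<notin> cylinder (b # v) \<or> \<omega> \<notin> cylinder (c # w)" for b c
    using cylinder_disjoint[of "b # v" "c # w"] assms by auto
  then have "(\<forall>b. \<omega> \<notin> cylinder (b # v)) \<or> (\<forall>c. \<omega> \<notin> cylinder (c # w))"
    by blast
  then have "a_word P \<pi> \<mu> v \<omega> = 0 \<or> a_word P \<pi> \<mu> w \<omega> = 0"
    by (auto simp: a_word_def e_cyl_eq_0)
  then show ?thesis by simp
qed

locale markov =
  fixes P :: "bool \<Rightarrow> bool \<Rightarrow> real" and \<pi> :: "bool \<Rightarrow> real" and \<mu> :: "seq measure"
  assumes markov: "markov_measure P \<pi> \<mu>"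
    and P_pos: "\<And>i j. 0 < P i j"
begin

sublocale prob_space \<mu>
  using markov by (simp add: markov_measure_def)

lemma sets_mu: "sets \<mu> = sets (\<Pi>\<^sub>M i\<in>(UNIV::nat set). count_space (UNIV::bool set))"
  using markov by (simp add: markov_measure_def)

lemma cylinder_in_sets [measurable]: "cylinder w \<in> sets \<mu>"
proof -
  let ?S = "\<Pi>\<^sub>M i\<in>(UNIV::nat set). count_space (UNIV::bool set)"
  have "{\<omega> \<in> space ?S. \<forall>i\<in>{..<length w}. \<omega> i = w ! i} \<in> sets ?S"
    by measurable
  moreover have "{\<omega> \<in> space ?S. \<forall>i\<in>{..<length w}. \<omega> i = w ! i} = cylinder w"
    by (auto simp: cylinder_def space_PiM)
  ultimately show ?thesis
    unfolding sets_mu by metis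
qed

lemma measure_cylinder_snoc:
  assumes "w \<noteq> []"
  shows "measure \<mu> (cylinder (w @ [c])) = measure \<mu> (cylinder w) * P (last w) c"
proof -
  have meas: "measure \<mu> (cylinder v) = \<pi> (hd v) * (\<Prod>i<length v - 1. P (v ! i) (v ! Suc i))"
    if "v \<noteq> []" for v
    using markov that by (simp add: markov_measure_def)
  obtain n where n: "length w = Suc n"
    using assms by (cases w) auto
  have "(\<Prod>i<Suc n. P ((w @ [c]) ! i) ((w @ [c]) ! Suc i)) =
      (\<Prod>i<n. P (w ! i) (w ! Suc i)) * P (last w) c"
    using n assms by (simp add: nth_append last_conv_nth)
  then show ?thesis
    using n assms by (simp add: meas)
qed

text \<open>Off \<open>cylinder w\<close> the factor \<open>e_cyl\<close> vanishes, and on it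
  \<open>f\<close> is constant, so only the mean of \<open>e_cyl\<close> matters. That mean is 0
  because the two square-root weights balance the conditional probabilities of the next
  letter.\<close>

lemma
  assumes f: "depends_on_prefix (length w) f" and "w \<noteq> []"
  shows integrable_mult_e_cyl: "integrable \<mu> (\<lambda>\<omega>. f \<omega> * e_cyl P \<mu> w \<omega>)"
    and integral_mult_e_cyl: "(\<integral>\<omega>. f \<omega> * e_cyl P \<mu> w \<omega> \<partial>\<mu>) = 0"
proof -
  \<comment> \<open>Beyond the end of \<open>w\<close> the entries \<open>w ! i\<close> are
    unspecified, but \<open>f\<close> sees only the first \<open>length w\<close> of them.\<close>
  define c where "c = f (\<lambda>i. w ! i)"
  have *: "f \<omega> * e_cyl P \<mu> w \<omega> = c * e_cyl P \<mu> w \<omega>" for \<omega>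
  proof (cases "\<omega> \<in> cylinder w")
    case True
    then have "f \<omega> = c"
      unfolding c_def by (intro depends_on_prefixD[OF f]) (simp add: cylinder_def)
    then show ?thesis by simp
  qed (simp add: e_cyl_eq_0)
  have ind: "integrable \<mu> (indicator (cylinder v) :: seq \<Rightarrow> real)" for v
    by (simp add: emeasure_eq_measure)
  show "integrable \<mu> (\<lambda>\<omega>. f \<omega> * e_cyl P \<mu> w \<omega>)"
    unfolding * unfolding e_cyl_def by (intro integrable_mult_right Bochner_Integration.integrable_diff ind)
  \<comment> \<open>Both sides equal the square root of \<open>p * q\<close>.\<close>
  have sqrt_balance: "sqrt (q / p) * p = sqrt (p / q) * q" if "0 < p" "0 < q" for p q :: real
    using that by (simp add: real_sqrt_divide field_simps)
  have int: "(\<integral>\<omega>. indicator (cylinder v) \<omega> \<partial>\<mu>) = measure \<mu> (cylinder v)" for v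
    by simp
  have "(\<integral>\<omega>. e_cyl P \<mu> w \<omega> \<partial>\<mu>) = 1 / sqrt (measure \<mu> (cylinder w)) *
      (sqrt (P (last w) True / P (last w) False) * measure \<mu> (cylinder (w @ [False])) -
       sqrt (P (last w) False / P (last w) True) * measure \<mu> (cylinder (w @ [True])))"
    unfolding e_cyl_def
    by (simp only: integral_mult_right_zero Bochner_Integration.integral_diff
        integrable_mult_right ind int)
  also have "\<dots> = 0"
    using sqrt_balance[OF P_pos[of "last w" False] P_pos[of "last w" True]]
    by (simp add: measure_cylinder_snoc[OF \<open>w \<noteq> []\<close>] mult.left_commute)
  finally show "(\<integral>\<omega>. f \<omega> * e_cyl P \<mu> w \<omega> \<partial>\<mu>) = 0"
    unfolding * by simp
qed

text \<open>\<open>a_word\<close> combines \<open>e_cyl\<close> of the two words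
  \<open>b # w\<close>, whose length \<open>Suc (length w)\<close> is exactly the prefix that
  \<open>f\<close> may see. The norm is only a constant divisor.\<close>

lemma integral_mult_hat_a_Word:
  assumes f: "depends_on_prefix (Suc (length w)) f"
  shows "(\<integral>\<omega>. f \<omega> * hat_a P \<pi> \<mu> (Word w) \<omega> \<partial>\<mu>) = 0"
proof -
  have i: "integrable \<mu> (\<lambda>\<omega>. f \<omega> * e_cyl P \<mu> (b # w) \<omega>)"
    and z: "(\<integral>\<omega>. f \<omega> * e_cyl P \<mu> (b # w) \<omega> \<partial>\<mu>) = 0" for b
    using f by (simp_all add: integrable_mult_e_cyl integral_mult_e_cyl)
  have "(\<integral>\<omega>. f \<omega> * a_word P \<pi> \<mu> w \<omega> \<partial>\<mu>) = 0"
    unfolding a_word_def right_diff_distrib mult.left_commute[of "f _"]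
    by (simp only: Bochner_Integration.integral_diff integrable_mult_right i
        integral_mult_right_zero z)
  then show ?thesis
    by (simp add: hat_a_def)
qed

text \<open>A shorter index has length at most \<open>len x - 1\<close>, so its function depends on
  at most \<open>len x + 1\<close> coordinates: one fewer than that of \<open>x\<close>, whose last
  coordinate therefore integrates out.\<close>

lemma integral_hat_a_triple_eq_0:
  assumes "len u < len x" "len v < len x"
  shows "(\<integral>\<omega>. hat_a P \<pi> \<mu> u \<omega> * hat_a P \<pi> \<mu> v \<omega> * hat_a P \<pi> \<mu> x \<omega> \<partial>\<mu>) = 0"
proof -
  obtain w where x: "x = Word w"
    using assms by (cases x) auto
  have "depends_on_prefix (Suc (length w)) (hat_a P \<pi> \<mu> t)" if "len t < len x" for t
    using depends_on_prefix_mono[OF depends_on_prefix_hat_a] that x by simp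
  then show ?thesis
    unfolding x using assms by (intro integral_mult_hat_a_Word depends_on_prefix_mult) (simp_all add: x)
qed

lemma integral_hat_a_triple_neq:
  assumes "len z < len x" "y \<noteq> x"
  shows "(\<integral>\<omega>. hat_a P \<pi> \<mu> x \<omega> * hat_a P \<pi> \<mu> z \<omega> * hat_a P \<pi> \<mu> y \<omega> \<partial>\<mu>) = 0"
proof (cases "len x" "len y" rule: linorder_cases)
  case less
  then show ?thesis
    using integral_hat_a_triple_eq_0[of x y z] assms by simp
next
  case equal
  \<comment> \<open>The common length exceeds \<open>len z\<close> and so is positive. This excludes
    \<open>Empty0\<close> and \<open>Empty1\<close>, two distinct indices of equal length to which
    the disjointness of supports for words does not apply.\<close>
  then obtain v w where "x = Word v" "y = Word w" "length v = length w" "v \<noteq> w"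
    using assms by (cases x; cases y) auto
  then have "hat_a P \<pi> \<mu> x \<omega> * hat_a P \<pi> \<mu> y \<omega> = 0" for \<omega>
    using a_word_mult_eq_0[of v w P \<pi> \<mu> \<omega>] by (auto simp: hat_a_def)
  then have "hat_a P \<pi> \<mu> x \<omega> * hat_a P \<pi> \<mu> z \<omega> * hat_a P \<pi> \<mu> y \<omega> = 0" for \<omega>
    by (metis mult_eq_0_iff)
  then show ?thesis by (simp only: Bochner_Integration.integral_zero)
next
  case greater
  then show ?thesis
    using integral_hat_a_triple_eq_0[of z x y] assms by (simp add: ac_simps)
qed

end

theorem proposition7p9:
  fixes r s :: real
    and P :: "bool \<Rightarrow> bool \<Rightarrow> real"
    and \<pi> :: "bool \<Rightarrow> real"
    and \<mu> :: "(nat \<Rightarrow> bool) measure"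
    and x z :: index
  assumes "0 < r" "r < 1" "0 < s" "s < 1"
    and "P = transition r s"
    and "stationary P \<pi>"
    and "markov_measure P \<pi> \<mu>"
    and "x \<in> indices" "z \<in> indices"
    and "len z < len x"
  shows "(\<lambda>y. (\<integral>\<omega>. hat_a P \<pi> \<mu> x \<omega> * hat_a P \<pi> \<mu> z \<omega> * hat_a P \<pi> \<mu> y \<omega> \<partial>\<mu>)\<^sup>2)
           summable_on indices
       \<and> (\<Sum>\<^sub>\<infinity>y\<in>indices.
            (\<integral>\<omega>. hat_a P \<pi> \<mu> x \<omega> * hat_a P \<pi> \<mu> z \<omega> * hat_a P \<pi> \<mu> y \<omega> \<partial>\<mu>)\<^sup>2)
         = (\<integral>\<omega>. (hat_a P \<pi> \<mu> x \<omega>)\<^sup>2 * hat_a P \<pi> \<mu> z \<omega> \<partial>\<mu>)\<^sup>2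
           + (\<integral>\<omega>. (hat_a P \<pi> \<mu> z \<omega>)\<^sup>2 * hat_a P \<pi> \<mu> x \<omega> \<partial>\<mu>)\<^sup>2
       \<and> (\<integral>\<omega>. (hat_a P \<pi> \<mu> x \<omega>)\<^sup>2 * hat_a P \<pi> \<mu> z \<omega> \<partial>\<mu>)\<^sup>2
           + (\<integral>\<omega>. (hat_a P \<pi> \<mu> z \<omega>)\<^sup>2 * hat_a P \<pi> \<mu> x \<omega> \<partial>\<mu>)\<^sup>2
         = (\<integral>\<omega>. (hat_a P \<pi> \<mu> x \<omega>)\<^sup>2 * hat_a P \<pi> \<mu> z \<omega> \<partial>\<mu>)\<^sup>2"
proof -
  have P_pos: "0 < P i j" for i j
    using assms(1-5) by (cases i; cases j) (simp_all add: transition_def)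
  interpret markov P \<pi> \<mu>
    using assms(7) P_pos by unfold_locales
  let ?I = "\<lambda>y. (\<integral>\<omega>. hat_a P \<pi> \<mu> x \<omega> * hat_a P \<pi> \<mu> z \<omega> * hat_a P \<pi> \<mu> y \<omega> \<partial>\<mu>)\<^sup>2"
  let ?X = "(\<integral>\<omega>. (hat_a P \<pi> \<mu> x \<omega>)\<^sup>2 * hat_a P \<pi> \<mu> z \<omega> \<partial>\<mu>)\<^sup>2"
  have "?I x = ?X"
    by (simp add: power2_eq_square ac_simps)
  then have "(?I has_sum ?X) {x}"
    using has_sum_finite[of "{x}" ?I] by simp
  \<comment> \<open>All terms other than the one at \<open>x\<close> vanish. Working with
    \<open>has_sum\<close> yields summability together with the value.\<close>
  then have "(?I has_sum ?X) indices"
    by (rule has_sum_cong_neutral[THEN iffD1, rotated -1])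
      (use assms(8,10) in \<open>auto simp: integral_hat_a_triple_neq\<close>)
  \<comment> \<open>Here \<open>z\<close> plays the role of both shorter indices.\<close>
  moreover have "(\<integral>\<omega>. (hat_a P \<pi> \<mu> z \<omega>)\<^sup>2 * hat_a P \<pi> \<mu> x \<omega> \<partial>\<mu>) = 0"
    using integral_hat_a_triple_eq_0[OF assms(10) assms(10)] by (simp add: power2_eq_square)
  ultimately show ?thesis
    by (auto dest: has_sum_imp_summable infsumI)
qed

end
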